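(* Let $\mathbb{P} \subset \mathbb{R}^{S\times A\times S}$ be any compact convex uncertainty set of transition kernels (not necessarily $s$-rectangular or $(s,a)$-rectangular). Then $\mathbb{P}$ can be reformulated as a factor matrix uncertainty set; that is, there exist an integer $r\ge 1$, coefficients $u^i_{sa}$ and a set $\mathcal{W}\subseteq\mathbb{R}_+^{S\times r}$ as in the definition of a factor matrix uncertainty set such that $\mathbb{P}$ equals the factor matrix uncertainty set defined by these data.
   Context: Let $\mathcal{S}$ be a finite set of states with $|\mathcal{S}|=S$ and $\mathcal{A}$ a finite set of actions with $|\mathcal{A}|=A$. A transition kernel is $P=(P_{sas'})\in\mathbb{R}_+^{S\times A\times S}$ with $\sum_{s'}P_{sas'}=1$ for all $(s,a)$; write $P_{sa}=(P_{sas'})_{s'}\in\mathbb{R}^S_+$ and $P_s=(P_{sas'})_{a,s'}$. An uncertainty set is a set of transition kernels. An uncertainty set is $(s,a)$-rectangular if it is a Cartesian product $\times_{(s,a)}\mathbb{P}_{sa}$ with $\mathbb{P}_{sa}\subseteq\mathbb{R}^S_+$, and $s$-rectangular if it is a Cartesian product $\times_{s}\mathbb{P}_s$ with $\mathbb{P}_s\subseteq\mathbb{R}_+^{A\times S}$. A factor matrix uncertainty set is a set of the form $$\mathbb{P}=\Big\{\Big(\sum_{i=1}^r u^i_{sa}w_{i,s'}\Big)_{sas'}\ \Big|\ W=(w_1,\dots,w_r)\in\mathcal{W}\Big\},$$ where $r\ge1$ is an integer, $u^i_{sa}\ge 0$ are fixed with $\sum_{i=1}^r u^i_{sa}=1$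 for all $(s,a)$, and $\mathcal{W}\subseteq\mathbb{R}_+^{S\times r}$ is a convex compact set such that every $W=(w_1,\dots,w_r)\in\mathcal{W}$ satisfies $\sum_{s'}w_{i,s'}=1$ for all $i=1,\dots,r$. *)

theory Defs
  imports "HOL-Analysis.Analysis"
begin

(* The entry P_{s a s'} is P $ s $ a $ s', for states 's and actions 'a. *)
definition transition_kernel :: "real^'s^'a^'s \<Rightarrow> bool" where
  "transition_kernel P \<longleftrightarrow>
     (\<forall>s a s'. 0 \<le> P $ s $ a $ s') \<and> (\<forall>s a. (\<Sum>s'\<in>UNIV. P $ s $ a $ s') = 1)"

definition uncertainty_set :: "(real^'s^'a^'s) set \<Rightarrow> bool" where
  "uncertainty_set \<P> \<longleftrightarrow> (\<forall>P\<in>\<P>. transition_kernel P)"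

(* Since r is quantified in the theorem, it cannot be a type index.  A matrix
   W = (w_1, ..., w_r) in R^{S x r} is the family of its columns, i.e. an element of the
   extensional function space {1..r} \<rightarrow>\<^sub>E UNIV, with w_{i,s'} = W i $ s'. *)
definition column_topology :: "nat \<Rightarrow> (nat \<Rightarrow> real^'s) topology" where
  "column_topology r = product_topology (\<lambda>_. euclidean) {1..r}"

(* The type class based convex does not apply: function types are not an instance of
   real_vector.  Restriction keeps the combination in the extensional function space. *)
definition convex_columns :: "nat \<Rightarrow> (nat \<Rightarrow> real^'s) set \<Rightarrow> bool" where
  "convex_columns r \<W> \<longleftrightarrow>
     (\<forall>V\<in>\<W>. \<forall>W\<in>\<W>. \<forall>p\<ge>0. \<forall>q\<ge>0. p + q = 1 \<longrightarrow>
        (\<lambda>i\<in>{1..r}. p *\<^sub>R V i + q *\<^sub>R W i) \<in> \<W>)"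

definition factor_coefficients :: "nat \<Rightarrow> (nat \<Rightarrow> 's \<Rightarrow> 'a \<Rightarrow> real) \<Rightarrow> bool" where
  "factor_coefficients r u \<longleftrightarrow>
     (\<forall>i\<in>{1..r}. \<forall>s a. 0 \<le> u i s a) \<and> (\<forall>s a. (\<Sum>i=1..r. u i s a) = 1)"

definition factor_matrices :: "nat \<Rightarrow> (nat \<Rightarrow> real^'s) set \<Rightarrow> bool" where
  "factor_matrices r \<W> \<longleftrightarrow>
     \<W> \<subseteq> {1..r} \<rightarrow>\<^sub>E {w. \<forall>s'. 0 \<le> w $ s'} \<and>
     convex_columns r \<W> \<and> compactin (column_topology r) \<W> \<and>
     (\<forall>W\<in>\<W>. \<forall>i\<in>{1..r}. (\<Sum>s'\<in>UNIV. W i $ s') = 1)"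

definition factor_matrix_uncertainty_set ::
    "nat \<Rightarrow> (nat \<Rightarrow> 's \<Rightarrow> 'a \<Rightarrow> real) \<Rightarrow> (nat \<Rightarrow> real^'s) set \<Rightarrow> (real^'s^'a^'s) set" where
  "factor_matrix_uncertainty_set r u \<W> =
     {(\<chi> s a s'. \<Sum>i=1..r. u i s a * W i $ s') | W. W \<in> \<W>}"

end

(* Take one factor for each state-action pair: u is the 0/1 indicator of the pair and
   the columns of W are the rows P_sa of the kernel, so that W ranges over a mere
   relabelling of the uncertainty set. *)
theory Submission
  imports Defs
begin

text \<open>Here \<open>e\<close> is arbitrary; in the end it enumerates all state-action pairs. The
  restriction to \<open>{1..r}\<close> places the result in the extensional function space that
  \<open>factor_matrices\<close> demands.\<close>

definition kernel_columns ::
    "nat \<Rightarrow> (nat \<Rightarrow> 's \<times> 'a) \<Rightarrow> real^'s^'a^'s \<Rightarrow> nat \<Rightarrow> real^'s" where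
  "kernel_columns r e P = (\<lambda>i\<in>{1..r}. P $ fst (e i) $ snd (e i))"

text \<open>In a product topology continuity is checked column by column, and each column is a
  coordinate projection of the kernel. This carries compactness over to the image.\<close>

lemma continuous_map_kernel_columns:
  "continuous_map euclidean (column_topology r) (kernel_columns r e)"
  unfolding column_topology_def kernel_columns_def continuous_map_componentwise
  by (auto intro!: continuous_intros)

lemma convex_columns_kernel_columns:
  assumes "convex \<P>"
  shows "convex_columns r (kernel_columns r e ` \<P>)"
  unfolding convex_columns_def
proof (intro ballI allI impI)
  fix V W and p q :: real
  assume "V \<in> kernel_columns r e ` \<P>" "W \<in> kernel_columns r e ` \<P>"
    and pq: "p \<ge> 0" "q \<ge> 0" "p + q = 1"
  then obtain P Q where PQ: "P \<in> \<P>" "Q \<in> \<P>"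
    and eq: "V = kernel_columns r e P" "W = kernel_columns r e Q"
    by auto
  have "p *\<^sub>R P + q *\<^sub>R Q \<in> \<P>"
    using assms PQ pq by (auto simp: convex_def)
  \<comment> \<open>The map commutes with convex combinations. Outside \<open>{1..r}\<close> both
    sides are \<open>undefined\<close>, so they agree as functions.\<close>
  moreover have "(\<lambda>i\<in>{1..r}. p *\<^sub>R V i + q *\<^sub>R W i) =
      kernel_columns r e (p *\<^sub>R P + q *\<^sub>R Q)"
    by (auto simp: eq kernel_columns_def fun_eq_iff)
  ultimately show "(\<lambda>i\<in>{1..r}. p *\<^sub>R V i + q *\<^sub>R W i) \<in> kernel_columns r e ` \<P>"
    by simp
qed

lemma factor_matrices_kernel_columns:
  fixes \<P> :: "(real^'s::finite^'a::finite^'s) set"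
  assumes "uncertainty_set \<P>" "compact \<P>" "convex \<P>"
  shows "factor_matrices r (kernel_columns r e ` \<P>)"
proof -
  have "compactin (column_topology r) (kernel_columns r e ` \<P>)"
    using image_compactin[OF _ continuous_map_kernel_columns] assms(2) by simp
  then show ?thesis
    using assms(1) convex_columns_kernel_columns[OF assms(3)]
    by (auto simp: factor_matrices_def kernel_columns_def uncertainty_set_def
        transition_kernel_def)
qed

text \<open>Exactly one index is sent to \<open>x\<close>, so a single term survives. With
  \<open>f\<close> constantly 1 this normalises the coefficients; with \<open>f\<close> an entry of
  the columns it recovers the kernel.\<close>

lemma sum_of_bool_bij_betw:
  fixes f :: "'i \<Rightarrow> 'b::semiring_1"
  assumes "bij_betw e I UNIV" and "finite I"
  shows "(\<Sum>i\<in>I. of_bool (e i = x) * f i) = f (inv_into I e x)"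
proof -
  have "x \<in> e ` I"
    using assms(1) by (simp add: bij_betw_def)
  then have mem: "inv_into I e x \<in> I" and inv: "e (inv_into I e x) = x"
    by (auto intro: inv_into_into f_inv_into_f)
  have "e i = x \<longleftrightarrow> i = inv_into I e x" if "i \<in> I" for i
    using that assms(1) inv by (auto simp: bij_betw_def)
  then have "(\<Sum>i\<in>I. of_bool (e i = x) * f i) =
      (\<Sum>i\<in>I. if i = inv_into I e x then f i else 0)"
    by (intro sum.cong) auto
  then show ?thesis
    using mem assms(2) by simp
qed

lemma factor_matrix_uncertainty_set_kernel_columns:
  fixes \<P> :: "(real^'s::finite^'a::finite^'s) set"
  assumes "bij_betw e {1..r} UNIV"
  shows "factor_matrix_uncertainty_set r (\<lambda>i s a. of_bool (e i = (s, a)))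
           (kernel_columns r e ` \<P>) = \<P>"
proof -
  have "(\<Sum>i=1..r. of_bool (e i = (s, a)) * kernel_columns r e P i $ s') = P $ s $ a $ s'"
    for P :: "real^'s^'a^'s" and s a s'
  proof -
    have "(s, a) \<in> e ` {1..r}"
      using assms by (simp add: bij_betw_def)
    \<comment> \<open>As this index lies in \<open>{1..r}\<close>, the restricted function yields
      the row of \<open>P\<close> at \<open>(s, a)\<close> there, not
      \<open>undefined\<close>.\<close>
    then have "inv_into {1..r} e (s, a) \<in> {1..r}" "e (inv_into {1..r} e (s, a)) = (s, a)"
      by (rule inv_into_into, rule f_inv_into_f)
    then show ?thesis
      unfolding sum_of_bool_bij_betw[OF assms finite_atLeastAtMost]
      by (simp add: kernel_columns_def)
  qed
  then have "(\<chi> s a s'. \<Sum>i=1..r. of_bool (e i = (s, a)) * kernel_columns r e P i $ s') = P" for P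
    by (simp only: vec_lambda_eta)
  then show ?thesis
    unfolding factor_matrix_uncertainty_set_def
    \<comment> \<open>Reading off columns and recombining them is the identity on kernels, so the
      set is the image of \<open>\<P>\<close> under the identity.\<close>
    by (simp only: Setcompr_eq_image image_image image_ident)
qed

theorem proposition2p1:
  fixes \<P> :: "(real^'s::finite^'a::finite^'s) set"
  assumes "uncertainty_set \<P>" and "compact \<P>" and "convex \<P>"
  shows "\<exists>(r::nat) (u :: nat \<Rightarrow> 's \<Rightarrow> 'a \<Rightarrow> real) (\<W> :: (nat \<Rightarrow> real^'s) set).
           r \<ge> 1 \<and> factor_coefficients r u \<and> factor_matrices r \<W> \<and>
           \<P> = factor_matrix_uncertainty_set r u \<W>"
proof -
  define r where "r = CARD('s \<times> 'a)"
  obtain e :: "nat \<Rightarrow> 's \<times> 'a" where e: "bij_betw e {1..r} UNIV"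
    using ex_bij_betw_nat_finite_1[OF finite] unfolding r_def by blast
  \<comment> \<open>Types are nonempty, so there is at least one state-action pair.\<close>
  have "r \<ge> 1"
    by (simp add: r_def Suc_le_eq)
  moreover have "factor_coefficients r (\<lambda>i s a. of_bool (e i = (s, a)))"
    using sum_of_bool_bij_betw[OF e, where f = "\<lambda>_. 1 :: real"]
    by (simp add: factor_coefficients_def)
  moreover have "factor_matrices r (kernel_columns r e ` \<P>)"
    using assms by (rule factor_matrices_kernel_columns)
  moreover have "\<P> = factor_matrix_uncertainty_set r (\<lambda>i s a. of_bool (e i = (s, a)))
      (kernel_columns r e ` \<P>)"
    using factor_matrix_uncertainty_set_kernel_columns[OF e] by simp
  ultimately show ?thesis
    by blast
qed

end
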